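(* Let $d \geq 4$. There exist positive constants $c_d, C_d$ and, for infinitely many $n$, a set of $n$ points in $\mathbb{E}^d$ that cannot be covered by any set of flats whose ranks sum to $d+1$, such that the set spans between $c_d n^{d-2}$ and $C_d n^{d-2}$ hyperplanes and between $c_d n^{d-1}$ and $C_d n^{d-1}$ $(d-2)$-flats.
   Context: The rank of a flat is one more than its dimension. A hyperplane is spanned by a point set if it passes through $d$ points of the set not all on a common $(d-2)$-flat; a $(d-2)$-flat is spanned by the set if it passes through $d-1$ points of the set not all on a common $(d-3)$-flat (i.e., $d-1$ affinely independent points).
   Formalization: The covering flats are required to be nonempty and proper: the whole space is itself a flat of rank d+1, so without this every set of points would be covered and the claim would be false. *)

theory Defs
  imports "HOL-Analysis.Analysis"
begin

text \<open>The dimension is an integer so that the empty set is the flat of dimension \<open>-1\<close>.\<close>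

definition is_flat :: "int \<Rightarrow> 'a::euclidean_space set \<Rightarrow> bool" where
  "is_flat k F \<longleftrightarrow> affine F \<and> aff_dim F = k"

definition flat_rank :: "'a::euclidean_space set \<Rightarrow> int" where
  "flat_rank F = aff_dim F + 1"

definition spanned_flats :: "nat \<Rightarrow> 'a::euclidean_space set \<Rightarrow> 'a set set" where
  "spanned_flats k P =
     {F. is_flat (int k) F \<and>
         (\<exists>S. S \<subseteq> P \<and> S \<subseteq> F \<and> card S = k + 1 \<and>
              \<not> (\<exists>G. is_flat (int k - 1) G \<and> S \<subseteq> G))}"

text \<open>
  The covering flats are required to be proper: the whole space is itself a flat of rank
  \<open>DIM('a) + 1\<close>, so without this restriction every set would be covered by flats whose ranks
  sum to \<open>DIM('a) + 1\<close>. For nonempty flats with this rank sum, being proper amounts to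
  there being at least two of them.
\<close>

definition covered_by_flats_of_rank_sum :: "nat \<Rightarrow> 'a::euclidean_space set \<Rightarrow> bool" where
  "covered_by_flats_of_rank_sum r P \<longleftrightarrow>
     (\<exists>\<F>. finite \<F> \<and>
          (\<forall>F\<in>\<F>. affine F \<and> F \<noteq> {} \<and> F \<noteq> UNIV) \<and>
          (\<Sum>F\<in>\<F>. flat_rank F) = int r \<and>
          P \<subseteq> \<Union>\<F>)"

end

theory Submission
  imports Defs
begin

text \<open>
  Single out a coordinate \<open>z\<close>, choose pairwise distinct reals \<open>c i\<close>, and take \<open>m\<close> points on each of
  the \<open>d - 1\<close> pairwise skew lines \<open>t e\<^sub>i + c\<^sub>i e\<^sub>z\<close>, \<open>i \<noteq> z\<close>. One point from each line gives
  \<open>m ^ (d - 1)\<close> different \<open>(d - 2)\<close>-flats. Among \<open>d\<close> points two lie on a common line, so a spanned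
  hyperplane contains a whole line and is determined by this line and \<open>d - 2\<close> further points; one
  line together with one point from each of the others does give \<open>m ^ (d - 2)\<close> different hyperplanes.
  For large \<open>m\<close>, each line lies in some member of a given covering. Containing \<open>k\<close> of the lines forces
  rank at least \<open>k + 1\<close>, and at least \<open>k + 2\<close> if \<open>k \<ge> 2\<close>, so a covering by at least two flats has
  rank sum at least \<open>d + 2\<close>.
\<close>

section \<open>Flats spanned by a finite set\<close>

text \<open>Starting from the affine hull of \<open>S\<close>, adjoin points of \<open>F\<close> one
  at a time; each raises the dimension by exactly one, so no intermediate dimension is
  skipped.\<close>

lemma ex_flat_between:
  fixes F :: "'a::euclidean_space set"
  assumes "affine F" "S \<subseteq> F" "aff_dim S \<le> j" "j \<le> aff_dim F"
  shows "\<exists>G. is_flat j G \<and> S \<subseteq> G \<and> G \<subseteq> F"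
  using assms(3,4)
proof (induction j rule: int_ge_induct)
  case base
  have "affine hull S \<subseteq> F"
    using assms(1,2) by (intro hull_minimal)
  moreover have "is_flat (aff_dim S) (affine hull S)"
    by (simp add: is_flat_def)
  ultimately show ?case
    using hull_subset[of S affine] by (intro exI[of _ "affine hull S"] conjI)
next
  case (step j)
  then obtain G where G: "affine G" "aff_dim G = j" "S \<subseteq> G" "G \<subseteq> F"
    by (auto simp: is_flat_def)
  with step have "G \<noteq> F" by auto
  with G obtain a where a: "a \<in> F" "a \<notin> G" by auto
  have "aff_dim (affine hull (insert a G)) = j + 1"
    using a G by (simp add: aff_dim_insert hull_same)
  moreover have "affine hull (insert a G) \<subseteq> F"
    using a G assms(1) by (intro hull_minimal) auto
  moreover have "S \<subseteq> affine hull (insert a G)"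
    using G by (auto intro: hull_inc)
  ultimately show ?case
    unfolding is_flat_def
    by (intro exI[of _ "affine hull (insert a G)"] conjI affine_affine_hull)
qed

text \<open>The definition only forbids flats of dimension exactly \<open>k - 1\<close> around
  \<open>S\<close>. A set \<open>S\<close> of smaller dimension would also lie in such a flat by
  \<open>ex_flat_between\<close>, so \<open>S\<close> has the full dimension of \<open>F\<close>.
  Upper bounds thus reduce to counting subsets of \<open>P\<close>.\<close>

lemma spanned_flatsE:
  assumes "F \<in> spanned_flats k P"
  obtains S where "S \<subseteq> P" "card S = k + 1" "F = affine hull S"
proof -
  from assms obtain S where F: "affine F" "aff_dim F = int k"
    and S: "S \<subseteq> P" "S \<subseteq> F" "card S = k + 1"
    and not: "\<not> (\<exists>G. is_flat (int k - 1) G \<and> S \<subseteq> G)"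
    by (auto simp: spanned_flats_def is_flat_def)
  have "\<not> aff_dim S \<le> int k - 1"
    using ex_flat_between[OF F(1) S(2), of "int k - 1"] F(2) not by auto
  then have "aff_dim S = aff_dim F"
    using aff_dim_subset[OF S(2)] F(2) by linarith
  then have "affine hull S = affine hull F"
    using aff_dim_eq_full_gen[OF S(2)] by blast
  then have "F = affine hull S"
    using F(1) by (simp add: hull_same)
  with S that show thesis by blast
qed

lemma affine_hull_in_spanned_flats:
  assumes "S \<subseteq> P" "\<not> affine_dependent S" "card S = k + 1"
  shows "affine hull S \<in> spanned_flats k P"
proof -
  have dim: "aff_dim S = int k"
    using assms(2,3) by (simp add: affine_independent_iff_card)
  have "\<not> (is_flat (int k - 1) G \<and> S \<subseteq> G)" for G
    using aff_dim_subset[of S G] dim by (auto simp: is_flat_def)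
  then show ?thesis
    using assms dim unfolding spanned_flats_def is_flat_def
    by (auto intro!: exI[of _ S] hull_inc)
qed

lemma card_subsets_le:
  assumes "finite A"
  shows "card {B. B \<subseteq> A \<and> card B = k} \<le> card A ^ k"
proof (cases "k \<le> card A")
  case True
  then show ?thesis using assms by (simp add: n_subsets binomial_le_pow)
qed (use assms in \<open>simp add: n_subsets binomial_eq_0\<close>)

lemma card_Compl_eq:
  fixes A :: "'a::finite set"
  shows "card (- A) = CARD('a) - card A"
  by (simp add: Compl_eq_Diff_UNIV card_Diff_subset)

lemma
  assumes "finite P"
  shows finite_spanned_flats: "finite (spanned_flats k P)"
    and card_spanned_flats_le: "card (spanned_flats k P) \<le> card P ^ (k + 1)"
proof -
  let ?A = "{S. S \<subseteq> P \<and> card S = k + 1}"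
  have sub: "spanned_flats k P \<subseteq> (hull) affine ` ?A"
    by (blast elim: spanned_flatsE)
  have fin: "finite ?A" using assms by simp
  show "finite (spanned_flats k P)"
    using sub fin by (meson finite_imageI finite_subset)
  have "card (spanned_flats k P) \<le> card ?A"
    using sub fin surj_card_le by blast
  also have "\<dots> \<le> card P ^ (k + 1)"
    by (rule card_subsets_le[OF assms])
  finally show "card (spanned_flats k P) \<le> card P ^ (k + 1)" .
qed

section \<open>The arrangement of skew lines\<close>

locale skew_lines =
  fixes z :: "'d::finite" and c :: "'d \<Rightarrow> real"
  assumes inj_c: "inj c"
begin

definition pt :: "'d \<Rightarrow> real \<Rightarrow> real ^ 'd" where
  "pt i t = t *\<^sub>R axis i 1 + c i *\<^sub>R axis z 1"

text \<open>Parameters start at 1 because the points with parameter 0 all lie on the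
  \<open>z\<close>-axis, which would spoil the independence of transversals.\<close>

definition pts :: "nat \<Rightarrow> (real ^ 'd) set" where
  "pts m = (\<lambda>(i, k). pt i (real k)) ` ((- {z}) \<times> {1..m})"

lemma inner_pt: "a \<bullet> pt i t = t * a $ i + c i * a $ z"
  by (simp add: pt_def inner_add_right inner_axis)

lemma pt_nth: "pt i t $ j = (if j = i then t else 0) + (if j = z then c i else 0)"
  by (simp add: pt_def axis_def)

lemma pt_eq_iff:
  assumes "i \<noteq> z" "j \<noteq> z"
  shows "pt i s = pt j t \<longleftrightarrow> i = j \<and> s = t"
proof
  assume eq: "pt i s = pt j t"
  have "c i = c j" using arg_cong[OF eq, of "\<lambda>x. x $ z"] assms by (simp add: pt_nth)
  then have "i = j" using inj_c by (simp add: inj_eq)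
  with arg_cong[OF eq, of "\<lambda>x. x $ i"] assms show "i = j \<and> s = t"
    by (simp add: pt_nth)
qed simp

lemma pt_in_pts: "i \<noteq> z \<Longrightarrow> 1 \<le> k \<Longrightarrow> k \<le> m \<Longrightarrow> pt i (real k) \<in> pts m"
  by (force simp: pts_def)

lemma ptsE:
  assumes "x \<in> pts m"
  obtains i k where "i \<noteq> z" "1 \<le> k" "k \<le> m" "x = pt i (real k)"
  using assms by (force simp: pts_def)

lemma finite_pts: "finite (pts m)"
  by (simp add: pts_def)

lemma card_pts: "card (pts m) = (CARD('d) - 1) * m"
proof -
  have "inj_on (\<lambda>(i, k). pt i (real k)) ((- {z}) \<times> {1..m})"
    by (auto simp: inj_on_def pt_eq_iff)
  then show ?thesis
    by (simp add: pts_def card_image card_cartesian_product card_Compl_eq)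
qed

lemma pt_in_affine:
  assumes "affine F" "pt i s \<in> F" "pt i t \<in> F" "s \<noteq> t"
  shows "pt i r \<in> F"
proof -
  define u where "u = (r - t) / (s - t)"
  have "u * (s - t) = r - t"
    using assms(4) by (simp add: u_def)
  then have "u * s + (1 - u) * t = r"
    by (simp add: algebra_simps)
  then have "pt i r = u *\<^sub>R pt i s + (1 - u) *\<^sub>R pt i t"
    by (simp add: pt_def algebra_simps flip: scaleR_add_left)
  then show ?thesis
    using mem_affine[OF assms(1-3), of u "1 - u"] by simp
qed

text \<open>Add the points one by one: all earlier points lie in the hyperplane where coordinate
  \<open>j\<close> vanishes, while the new point has \<open>j\<close>-th coordinate
  \<open>t j\<close>, which is nonzero. The starting set \<open>B\<close> leaves room for two points
  on a common line.\<close>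

lemma independent_transversal:
  assumes B: "\<not> affine_dependent B"
    and "z \<notin> J" "\<And>i. i \<in> J \<Longrightarrow> t i \<noteq> 0"
    and "\<And>x i. x \<in> B \<Longrightarrow> i \<in> J \<Longrightarrow> x $ i = 0"
  shows "\<not> affine_dependent (B \<union> (\<lambda>i. pt i (t i)) ` J)"
  using finite[of J] assms(2-)
proof (induction J rule: finite_induct)
  case empty
  then show ?case using B by simp
next
  case (insert j J)
  let ?H = "{x :: real ^ 'd. axis j 1 \<bullet> x = 0}"
  have "affine hull (B \<union> (\<lambda>i. pt i (t i)) ` J) \<subseteq> ?H"
    using insert by (intro hull_minimal affine_hyperplane) (auto simp: inner_axis' pt_nth)
  moreover have "pt j (t j) \<notin> ?H"
    using insert.prems by (auto simp: inner_axis' pt_nth)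
  ultimately have "pt j (t j) \<notin> affine hull (B \<union> (\<lambda>i. pt i (t i)) ` J)" by blast
  moreover have "\<not> affine_dependent (B \<union> (\<lambda>i. pt i (t i)) ` J)"
    using insert by simp
  ultimately have "\<not> affine_dependent (insert (pt j (t j)) (B \<union> (\<lambda>i. pt i (t i)) ` J))"
    by (intro affine_independent_insert)
  then show ?case by simp
qed

subsection \<open>Counting the spanned flats\<close>

lemma card_flats_lower:
  assumes "CARD('d) \<ge> 2"
  shows "m ^ (CARD('d) - 1) \<le> card (spanned_flats (CARD('d) - 2) (pts m))"
proof -
  let ?I = "- {z} :: 'd set"
  define S where "S t = (\<lambda>i. pt i (real (t i))) ` ?I" for t :: "'d \<Rightarrow> nat"
  let ?T = "?I \<rightarrow>\<^sub>E {1..m}"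
  have T: "0 < t i" "1 \<le> t i" "t i \<le> m" if "t \<in> ?T" "i \<noteq> z" for t i
    using PiE_mem[OF that(1), of i] that(2) by auto
  have in_flats: "affine hull (S t) \<in> spanned_flats (CARD('d) - 2) (pts m)" if t: "t \<in> ?T" for t
  proof (rule affine_hull_in_spanned_flats)
    show "S t \<subseteq> pts m" using T(2,3)[OF t] by (auto simp: S_def intro!: pt_in_pts)
    show "\<not> affine_dependent (S t)"
      using independent_transversal[of "{}" ?I "\<lambda>i. real (t i)"] T(1)[OF t]
      by (fastforce simp: S_def)
    have "inj_on (\<lambda>i. pt i (real (t i))) ?I"
      by (auto simp: inj_on_def pt_eq_iff)
    then show "card (S t) = CARD('d) - 2 + 1"
      using assms by (simp add: S_def card_image card_Compl_eq)
  qed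
  \<comment> \<open>The flat meets line \<open>i\<close> at no marked point other than the chosen
    one, so the choice \<open>t\<close> can be read off from the flat.\<close>
  have mem: "s = t i" if t: "t \<in> ?T" and i: "i \<noteq> z" and s: "pt i (real s) \<in> affine hull (S t)" for t i s
  proof -
    \<comment> \<open>The hyperplane with normal \<open>a\<close> and value 1 contains the flat, is
      parallel to the \<open>z\<close>-axis, and meets line \<open>i\<close> only at parameter
      \<open>t i\<close>.\<close>
    define a :: "real ^ 'd" where "a = (\<chi> i. if i = z then 0 else 1 / real (t i))"
    have ip: "a \<bullet> pt j r = r / real (t j)" if "j \<noteq> z" for j r
      using that by (simp add: inner_pt a_def)
    have "S t \<subseteq> {x. a \<bullet> x = 1}"
    proof
      fix x assume "x \<in> S t"
      then obtain j where "j \<noteq> z" "x = pt j (real (t j))" by (auto simp: S_def)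
      then show "x \<in> {x. a \<bullet> x = 1}" using T(1)[OF t] by (simp add: ip)
    qed
    then have "affine hull (S t) \<subseteq> {x. a \<bullet> x = 1}"
      by (rule hull_minimal) (rule affine_hyperplane)
    with s have "real s / real (t i) = 1" using i ip by auto
    then show ?thesis by (auto simp: divide_eq_1_iff)
  qed
  have "inj_on (\<lambda>t. affine hull (S t)) ?T"
  proof (rule inj_onI)
    fix t t' assume t: "t \<in> ?T" "t' \<in> ?T" and eq: "affine hull (S t) = affine hull (S t')"
    show "t = t'"
    proof (rule PiE_ext[OF t])
      fix i assume i: "i \<in> ?I"
      then have "pt i (real (t i)) \<in> affine hull (S t)"
        by (intro hull_inc) (simp add: S_def)
      with i show "t i = t' i"
        unfolding eq by (intro mem[OF t(2)]) auto
    qed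
  qed
  moreover have "card ?T = m ^ (CARD('d) - 1)"
    by (simp add: card_funcsetE card_Compl_eq)
  ultimately show ?thesis
    using card_inj_on_le[of _ ?T "spanned_flats (CARD('d) - 2) (pts m)"] in_flats
      finite_spanned_flats[OF finite_pts] by (metis (no_types, lifting) image_subsetI)
qed

text \<open>A fixed line \<open>k\<close>, represented by its points with parameters 1 and 2, is
  joined to one point on each of the other \<open>d - 2\<close> lines; the hyperplane determines
  these points.\<close>

lemma card_hyperplanes_lower:
  assumes "CARD('d) \<ge> 2" "m \<ge> 2"
  shows "m ^ (CARD('d) - 2) \<le> card (spanned_flats (CARD('d) - 1) (pts m))"
proof -
  obtain k :: 'd where k: "k \<noteq> z"
  proof -
    have "card (- {z}) \<noteq> 0" using assms(1) by (simp add: card_Compl_eq)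
    then show thesis using that by (auto simp: card_eq_0_iff)
  qed
  let ?I = "- {z, k} :: 'd set"
  let ?B = "{pt k 1, pt k 2}"
  define S where "S t = ?B \<union> (\<lambda>i. pt i (real (t i))) ` ?I" for t :: "'d \<Rightarrow> nat"
  let ?T = "?I \<rightarrow>\<^sub>E {1..m}"
  have cardI: "card ?I = CARD('d) - 2"
    using k by (simp add: card_Compl_eq)
  have T: "0 < t i" "1 \<le> t i" "t i \<le> m" if "t \<in> ?T" "i \<noteq> z" "i \<noteq> k" for t i
    using PiE_mem[OF that(1), of i] that(2,3) by auto
  have in_flats: "affine hull (S t) \<in> spanned_flats (CARD('d) - 1) (pts m)" if t: "t \<in> ?T" for t
  proof (rule affine_hull_in_spanned_flats)
    show "S t \<subseteq> pts m"
      using T(2,3)[OF t] pt_in_pts[OF k, of 1 m] pt_in_pts[OF k, of 2 m] assms(2)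
      by (auto simp: S_def intro!: pt_in_pts)
    show "\<not> affine_dependent (S t)"
      unfolding S_def
      by (intro independent_transversal affine_independent_2) (auto simp: pt_nth T(1)[OF t])
    have "inj_on (\<lambda>i. pt i (real (t i))) ?I"
      by (auto simp: inj_on_def pt_eq_iff)
    moreover have "?B \<inter> (\<lambda>i. pt i (real (t i))) ` ?I = {}" "card ?B = 2"
      using k by (auto simp: pt_eq_iff)
    ultimately show "card (S t) = CARD('d) - 1 + 1"
      using assms cardI unfolding S_def by (subst card_Un_disjoint) (auto simp: card_image)
  qed
  have mem: "s = t i" if t: "t \<in> ?T" and i: "i \<noteq> z" "i \<noteq> k"
    and s: "pt i (real s) \<in> affine hull (S t)" for t i s
  proof -
    \<comment> \<open>An explicit equation of the hyperplane: \<open>a\<close> has the constant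
      value \<open>c k\<close> on line \<open>k\<close>, and on line \<open>j\<close> it
      interpolates from \<open>c j\<close> at parameter 0 to \<open>c k\<close> at parameter
      \<open>t j\<close>. Since \<open>c j\<close> and \<open>c k\<close> differ, the value
      \<open>c k\<close> is attained there only once.\<close>
    define a :: "real ^ 'd" where
      "a = (\<chi> i. if i = z then 1 else if i = k then 0 else (c k - c i) / real (t i))"
    have ip: "a \<bullet> pt j r = c j + (c k - c j) * (r / real (t j))" if "j \<noteq> z" "j \<noteq> k" for j r
      using that by (simp add: inner_pt a_def)
    have ipk: "a \<bullet> pt k r = c k" for r
      using k by (simp add: inner_pt a_def)
    have "S t \<subseteq> {x. a \<bullet> x = c k}"
    proof
      fix x assume "x \<in> S t"
      then consider r where "x = pt k r" | j where "j \<noteq> z" "j \<noteq> k" "x = pt j (real (t j))"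
        by (auto simp: S_def)
      then show "x \<in> {x. a \<bullet> x = c k}"
      proof cases
        case 1
        then show ?thesis by (simp add: ipk)
      next
        case 2
        then show ?thesis using T(1)[OF t, of j] by (simp add: ip)
      qed
    qed
    then have "affine hull (S t) \<subseteq> {x. a \<bullet> x = c k}"
      by (rule hull_minimal) (rule affine_hyperplane)
    with s have "c i + (c k - c i) * (real s / real (t i)) = c k" using i ip by auto
    then have "(c k - c i) * (real s / real (t i) - 1) = 0" by (simp add: algebra_simps)
    moreover have "c k \<noteq> c i" using i inj_c by (simp add: inj_eq)
    ultimately show ?thesis by (auto simp: divide_eq_1_iff)
  qed
  have "inj_on (\<lambda>t. affine hull (S t)) ?T"
  proof (rule inj_onI)
    fix t t' assume t: "t \<in> ?T" "t' \<in> ?T" and eq: "affine hull (S t) = affine hull (S t')"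
    show "t = t'"
    proof (rule PiE_ext[OF t])
      fix i assume i: "i \<in> ?I"
      then have "pt i (real (t i)) \<in> affine hull (S t)"
        by (intro hull_inc) (simp add: S_def)
      with i show "t i = t' i"
        unfolding eq by (intro mem[OF t(2)]) auto
    qed
  qed
  moreover have "card ?T = m ^ (CARD('d) - 2)"
    using cardI by (simp add: card_funcsetE)
  ultimately show ?thesis
    using card_inj_on_le[of _ ?T "spanned_flats (CARD('d) - 1) (pts m)"] in_flats
      finite_spanned_flats[OF finite_pts] by (metis (no_types, lifting) image_subsetI)
qed

lemma card_hyperplanes_upper:
  assumes "CARD('d) \<ge> 2"
  shows "card (spanned_flats (CARD('d) - 1) (pts m)) \<le> CARD('d) * card (pts m) ^ (CARD('d) - 2)"
proof -
  \<comment> \<open>A code for a hyperplane: a line and \<open>d - 2\<close> further points. The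
    points with parameters 1 and 2 merely name the line and need not lie in \<open>pts m\<close>;
    letting the index run over \<open>z\<close> as well only overcounts.\<close>
  let ?A = "(UNIV :: 'd set) \<times> {T. T \<subseteq> pts m \<and> card T = CARD('d) - 2}"
  let ?f = "\<lambda>(i, T). affine hull ({pt i 1, pt i 2} \<union> T)"
  have sub: "spanned_flats (CARD('d) - 1) (pts m) \<subseteq> ?f ` ?A"
  proof
    fix F assume "F \<in> spanned_flats (CARD('d) - 1) (pts m)"
    then obtain S where S: "S \<subseteq> pts m" "card S = CARD('d) - 1 + 1" and F: "F = affine hull S"
      by (rule spanned_flatsE)
    have "\<forall>x\<in>S. \<exists>i s. i \<noteq> z \<and> x = pt i s"
      using S(1) by (meson ptsE subsetD)
    then obtain l s where l: "\<And>x. x \<in> S \<Longrightarrow> l x \<noteq> z \<and> x = pt (l x) (s x)"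
      by metis
    \<comment> \<open>There are \<open>d\<close> points on \<open>d - 1\<close> lines, so two of
      them share a line.\<close>
    have "card (l ` S) \<le> card (- {z})"
      using l by (intro card_mono) auto
    then have "\<not> inj_on l S"
      using S(2) assms by (intro pigeonhole) (simp add: card_Compl_eq)
    then obtain x y where xy: "x \<in> S" "y \<in> S" "x \<noteq> y" "l x = l y"
      by (auto simp: inj_on_def)
    let ?T = "S - {x, y}" and ?i = "l x"
    have x: "x = pt ?i (s x)" and y: "y = pt ?i (s y)"
      using l xy by metis+
    with xy have ne: "s x \<noteq> s y" by metis
    have "finite S" using S(2) by (simp add: card_ge_0_finite)
    then have "card ?T = CARD('d) - 2"
      using xy S(2) by (simp add: card_Diff_subset)
    moreover have "affine hull S = affine hull ({pt ?i 1, pt ?i 2} \<union> ?T)"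
    \<comment> \<open>Either pair of distinct points on line \<open>l x\<close> generates the whole
      line, so exchanging the pairs keeps the hull.\<close>
    proof (rule subset_antisym; rule hull_minimal)
      have "pt ?i r \<in> affine hull S" for r
        using pt_in_affine[OF affine_affine_hull _ _ ne, of ?i S] x y xy hull_inc by metis
      then show "{pt ?i 1, pt ?i 2} \<union> ?T \<subseteq> affine hull S"
        by (auto intro: hull_inc)
      have "pt ?i r \<in> affine hull ({pt ?i 1, pt ?i 2} \<union> ?T)" for r
        by (rule pt_in_affine[of _ _ 1 2]) (auto intro: hull_inc)
      then have "{x, y} \<subseteq> affine hull ({pt ?i 1, pt ?i 2} \<union> ?T)"
        using x y by (metis empty_subsetI insert_subset)
      then show "S \<subseteq> affine hull ({pt ?i 1, pt ?i 2} \<union> ?T)"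
        by (auto intro: hull_inc)
    qed simp_all
    ultimately show "F \<in> ?f ` ?A"
      using F S(1) by (intro image_eqI[of _ _ "(?i, ?T)"]) auto
  qed
  have "card (spanned_flats (CARD('d) - 1) (pts m)) \<le> card ?A"
    by (rule surj_card_le[OF _ sub]) (simp add: finite_pts)
  also have "\<dots> \<le> CARD('d) * card (pts m) ^ (CARD('d) - 2)"
    by (simp add: card_cartesian_product card_subsets_le[OF finite_pts])
  finally show ?thesis .
qed

subsection \<open>Coverings\<close>

definition lines_in :: "(real ^ 'd) set \<Rightarrow> 'd set" where
  "lines_in F = {i. i \<noteq> z \<and> (\<forall>t. pt i t \<in> F)}"

text \<open>The rank is one more than the dimension of the direction space \<open>D\<close>. Each
  contained line puts its axis vector into \<open>D\<close>. Two lines \<open>i\<close> and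
  \<open>j\<close> also put \<open>axis z 1\<close> there, since their points at parameter 0 differ
  by \<open>c i - c j\<close> times that vector; this is the extra unit of rank.\<close>

lemma flat_rank_ge:
  assumes "affine F" "F \<noteq> {}"
  shows "flat_rank F \<ge> card (lines_in F) + 1"
    and "card (lines_in F) \<ge> 2 \<Longrightarrow> flat_rank F \<ge> card (lines_in F) + 2"
proof -
  obtain a where a: "a \<in> F" using assms(2) by auto
  define D where "D = (\<lambda>x. x - a) ` F"
  have sub: "subspace D"
    unfolding D_def by (rule affine_diffs_subspace_subtract[OF assms(1) a])
  have rank: "flat_rank F = int (dim D) + 1"
    using aff_dim_dim_affine_diffs[OF assms(1) a] by (simp add: flat_rank_def D_def)
  have diff: "x - y \<in> D" if "x \<in> F" "y \<in> F" for x y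
    using subspace_diff[OF sub, of "x - a" "y - a"] that by (simp add: D_def)
  have ax: "axis i 1 \<in> D" if "i \<in> lines_in F" for i
  proof -
    have "pt i 1 - pt i 0 \<in> D"
      using that by (intro diff) (simp_all add: lines_in_def)
    then show ?thesis by (simp add: pt_def)
  qed
  have dim: "card J \<le> dim D" if "\<And>i. i \<in> J \<Longrightarrow> axis i (1::real) \<in> D" for J
  proof -
    let ?E = "(\<lambda>i. axis i (1::real)) ` J"
    have "independent ?E"
      by (rule independent_mono[OF independent_Basis]) (auto simp: axis_in_Basis_iff)
    then have "card ?E \<le> dim D"
      using that by (intro independent_card_le_dim) auto
    moreover have "card ?E = card J"
      by (intro card_image) (auto simp: inj_on_def axis_eq_axis)
    ultimately show ?thesis by simp
  qed
  show "flat_rank F \<ge> card (lines_in F) + 1"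
    using dim[of "lines_in F"] ax rank by simp
  assume two: "card (lines_in F) \<ge> 2"
  then obtain i j where ij: "i \<in> lines_in F" "j \<in> lines_in F" "i \<noteq> j"
    by (metis One_nat_def card_le_Suc0_iff_eq finite not_less_eq_eq numeral_2_eq_2)
  have "(c i - c j) *\<^sub>R axis z 1 \<in> D"
  proof -
    have "pt i 0 - pt j 0 \<in> D"
      using ij by (intro diff) (simp_all add: lines_in_def)
    then show ?thesis by (simp add: pt_def scaleR_diff_left)
  qed
  moreover have "c i - c j \<noteq> 0" using ij inj_c by (simp add: inj_eq)
  ultimately have "axis z 1 \<in> D"
    using subspace_scale[OF sub, of "(c i - c j) *\<^sub>R axis z 1" "1 / (c i - c j)"] by simp
  then have "card (insert z (lines_in F)) \<le> dim D"
    using ax by (intro dim) auto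
  then show "flat_rank F \<ge> card (lines_in F) + 2"
    using rank by (simp add: lines_in_def)
qed

lemma not_covered_pts:
  assumes d: "CARD('d) \<ge> 4" and m: "m \<ge> CARD('d) + 2"
  shows "\<not> covered_by_flats_of_rank_sum (CARD('d) + 1) (pts m)"
proof
  assume "covered_by_flats_of_rank_sum (CARD('d) + 1) (pts m)"
  then obtain \<F> where fin: "finite \<F>"
    and flat: "\<And>F. F \<in> \<F> \<Longrightarrow> affine F \<and> F \<noteq> {} \<and> F \<noteq> UNIV"
    and rsum: "(\<Sum>F\<in>\<F>. flat_rank F) = int (CARD('d) + 1)"
    and cov: "pts m \<subseteq> \<Union>\<F>"
    unfolding covered_by_flats_of_rank_sum_def by blast
  have rank1: "flat_rank F \<ge> card (lines_in F) + 1" if "F \<in> \<F>" for F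
    using flat_rank_ge(1) flat[OF that] by blast
  \<comment> \<open>Nonempty flats have rank at least 1, so there are at most \<open>d + 1\<close>
    of them, fewer than the \<open>m\<close> points on each line. By pigeonhole some flat then has
    two points of a given line and contains it.\<close>
  have "(\<Sum>F\<in>\<F>. 1) \<le> (\<Sum>F\<in>\<F>. flat_rank F)"
    by (rule sum_mono) (use rank1 in force)
  then have card_lt: "card \<F> < m" using rsum m by simp
  have "\<exists>F\<in>\<F>. i \<in> lines_in F" if i: "i \<noteq> z" for i
  proof -
    have "\<forall>k\<in>{1..m}. \<exists>F\<in>\<F>. pt i (real k) \<in> F"
      using pt_in_pts[OF i] cov by fastforce
    then obtain f where f: "\<And>k. k \<in> {1..m} \<Longrightarrow> f k \<in> \<F> \<and> pt i (real k) \<in> f k"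
      by metis
    have "card (f ` {1..m}) \<le> card \<F>"
      using f fin by (intro card_mono) auto
    then have "\<not> inj_on f {1..m}"
      using card_lt by (intro pigeonhole) simp
    then obtain k l where kl: "k \<in> {1..m}" "l \<in> {1..m}" "k \<noteq> l" "f k = f l"
      by (auto simp: inj_on_def)
    have "pt i t \<in> f k" for t
    proof (rule pt_in_affine)
      show "affine (f k)" "pt i (real k) \<in> f k"
        using f[OF kl(1)] flat by blast+
      show "pt i (real l) \<in> f k"
        using f[OF kl(2)] kl(4) by simp
      show "real k \<noteq> real l" using kl(3) by simp
    qed
    then show ?thesis
      using i f[OF kl(1)] by (auto simp: lines_in_def)
  qed
  then have "- {z} \<subseteq> (\<Union>F\<in>\<F>. lines_in F)" by blast
  then have "card (- {z}) \<le> card (\<Union>F\<in>\<F>. lines_in F)"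
    by (intro card_mono) auto
  also have "\<dots> \<le> (\<Sum>F\<in>\<F>. card (lines_in F))"
    by (rule card_UN_le[OF fin])
  finally have lines: "CARD('d) - 1 \<le> (\<Sum>F\<in>\<F>. card (lines_in F))"
    by (simp add: card_Compl_eq)
  have rsum_ge: "(\<Sum>F\<in>\<F>. int (card (lines_in F) + 1)) = int (\<Sum>F\<in>\<F>. card (lines_in F)) + card \<F>"
    by (simp add: sum.distrib)
  have "(\<Sum>F\<in>\<F>. int (card (lines_in F) + 1)) \<le> int (CARD('d) + 1)"
    unfolding rsum[symmetric] by (rule sum_mono) (use rank1 in force)
  \<comment> \<open>The \<open>d - 1\<close> lines plus one unit per flat must fit into the rank sum
    \<open>d + 1\<close>.\<close>
  then have le2: "card \<F> \<le> 2" using lines unfolding rsum_ge by linarith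
  \<comment> \<open>Otherwise two flats would hold at most two lines, but \<open>d - 1\<close> is at
    least 3.\<close>
  have "\<exists>F\<in>\<F>. card (lines_in F) \<ge> 2"
  proof (rule ccontr)
    assume "\<not> ?thesis"
    then have "(\<Sum>F\<in>\<F>. card (lines_in F)) \<le> (\<Sum>F\<in>\<F>. 1)"
      by (intro sum_mono) force
    with lines le2 d show False by simp
  qed
  then obtain F0 where F0: "F0 \<in> \<F>" "card (lines_in F0) \<ge> 2" by blast
  \<comment> \<open>The extra rank of \<open>F0\<close> makes the estimate strict, leaving room for
    a single flat. That flat has rank \<open>d + 1\<close>, so it is the whole space, contrary to
    properness.\<close>
  have "(\<Sum>F\<in>\<F>. int (card (lines_in F) + 1)) < (\<Sum>F\<in>\<F>. flat_rank F)"
    using fin F0 flat_rank_ge(2)[of F0] flat[of F0] rank1 by (intro sum_strict_mono_ex1) force+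
  then have "card \<F> \<le> 1"
    using lines rsum unfolding rsum_ge by linarith
  moreover have "card \<F> > 0" using F0(1) fin card_gt_0_iff by blast
  ultimately have "card \<F> = 1" by linarith
  then have "\<F> = {F0}" using F0(1) card_1_singletonE by blast
  then have "aff_dim F0 = DIM(real ^ 'd)"
    using rsum by (simp add: flat_rank_def)
  then show False
    using flat[OF F0(1)] aff_dim_eq_full[of F0] by (simp add: hull_same)
qed

end

section \<open>Constants and infinitely many cardinalities\<close>

theorem theorem4:
  fixes d :: nat
  assumes d_eq: "d = CARD('d::finite)" and d_ge: "d \<ge> 4"
  shows "\<exists>c C :: real. 0 < c \<and> 0 < C \<and>
    infinite {n :: nat. \<exists>P :: (real ^ 'd) set.
      finite P \<and> card P = n \<and>
      \<not> covered_by_flats_of_rank_sum (d + 1) P \<and>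
      c * real n ^ (d - 2) \<le> real (card (spanned_flats (d - 1) P)) \<and>
      real (card (spanned_flats (d - 1) P)) \<le> C * real n ^ (d - 2) \<and>
      c * real n ^ (d - 1) \<le> real (card (spanned_flats (d - 2) P)) \<and>
      real (card (spanned_flats (d - 2) P)) \<le> C * real n ^ (d - 1)}"
proof -
  obtain h :: "'d \<Rightarrow> nat" where "inj h"
    using finite_imp_inj_to_nat_seg[OF finite_class.finite_UNIV] by blast
  then have "inj (\<lambda>i. real (h i))" by (simp add: inj_def)
  \<comment> \<open>Any coordinate can serve as \<open>z\<close>, so an arbitrary one is taken; the
    distinct heights come from numbering the coordinates.\<close>
  then interpret skew_lines "undefined :: 'd" "\<lambda>i. real (h i)"
    by unfold_locales
  \<comment> \<open>With \<open>n = (d - 1) * m\<close>, the lower bound \<open>m ^ k\<close> is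
    \<open>n ^ k\<close> divided by \<open>(d - 1) ^ k\<close>; the larger exponent
    \<open>d - 1\<close> gives one constant for both counts.\<close>
  define c where "c = 1 / real (d - 1) ^ (d - 1)"
  have c: "c * real ((d - 1) * m) ^ k \<le> real N" if "k \<le> d - 1" "m ^ k \<le> N" for k m N
  proof -
    have "real (d - 1) ^ k \<le> real (d - 1) ^ (d - 1)"
      using that(1) d_ge by (intro power_increasing) auto
    then have "c * real (d - 1) ^ k \<le> 1"
      using d_ge by (simp add: c_def divide_le_eq_1)
    then have "c * real (d - 1) ^ k * real m ^ k \<le> 1 * real m ^ k"
      by (intro mult_right_mono) auto
    also have "\<dots> \<le> real N"
      using that(2) by (metis mult_1 of_nat_le_iff of_nat_power)
    finally show ?thesis
      by (simp only: of_nat_mult power_mult_distrib mult.assoc)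
  qed
  \<comment> \<open>The upper constant is \<open>d\<close>, the factor from
    \<open>card_hyperplanes_upper\<close>; for the \<open>(d - 2)\<close>-flats the constant 1 would
    do and is weakened.\<close>
  let ?N = "{n. \<exists>P :: (real ^ 'd) set.
      finite P \<and> card P = n \<and>
      \<not> covered_by_flats_of_rank_sum (d + 1) P \<and>
      c * real n ^ (d - 2) \<le> real (card (spanned_flats (d - 1) P)) \<and>
      real (card (spanned_flats (d - 1) P)) \<le> real d * real n ^ (d - 2) \<and>
      c * real n ^ (d - 1) \<le> real (card (spanned_flats (d - 2) P)) \<and>
      real (card (spanned_flats (d - 2) P)) \<le> real d * real n ^ (d - 1)}"
  have "(d - 1) * m \<in> ?N" if m: "m \<ge> d + 2" for m
  proof -
    let ?n = "(d - 1) * m"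
    have n: "card (pts m) = ?n" using card_pts d_eq by simp
    have "\<not> covered_by_flats_of_rank_sum (d + 1) (pts m)"
      using not_covered_pts m d_ge unfolding d_eq by blast
    moreover have "c * real ?n ^ (d - 2) \<le> real (card (spanned_flats (d - 1) (pts m)))"
      using card_hyperplanes_lower[of m] m d_ge unfolding d_eq[symmetric] by (intro c) auto
    moreover have "real (card (spanned_flats (d - 1) (pts m))) \<le> real d * real ?n ^ (d - 2)"
    proof -
      have "card (spanned_flats (d - 1) (pts m)) \<le> d * ?n ^ (d - 2)"
        using card_hyperplanes_upper[of m] d_ge n unfolding d_eq by simp
      then show ?thesis by (metis of_nat_le_iff of_nat_mult of_nat_power)
    qed
    moreover have "c * real ?n ^ (d - 1) \<le> real (card (spanned_flats (d - 2) (pts m)))"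
      using card_flats_lower[of m] d_ge unfolding d_eq[symmetric] by (intro c) auto
    moreover have "real (card (spanned_flats (d - 2) (pts m))) \<le> real d * real ?n ^ (d - 1)"
    proof -
      have "d - 2 + 1 = d - 1" using d_ge by simp
      then have "card (spanned_flats (d - 2) (pts m)) \<le> ?n ^ (d - 1)"
        using card_spanned_flats_le[OF finite_pts, of "d - 2" m] n by metis
      also have "\<dots> \<le> d * ?n ^ (d - 1)" using d_ge by simp
      finally show ?thesis by (metis of_nat_le_iff of_nat_mult of_nat_power)
    qed
    ultimately show ?thesis
      using finite_pts n by blast
  qed
  then have "(\<lambda>m. (d - 1) * m) ` {d + 2..} \<subseteq> ?N" by blast
  moreover have "inj_on (\<lambda>m. (d - 1) * m) {d + 2..}"
    using d_ge by (auto simp: inj_on_def)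
  ultimately have "infinite ?N"
    by (meson finite_imageD finite_subset infinite_Ici)
  moreover have "c > 0" "real d > 0" using d_ge by (auto simp: c_def)
  ultimately show ?thesis by blast
qed

end
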